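(* Let $q\in\mathbb{C}$ with $0<|q|<1$ and let $w\in\mathbb{C}\setminus\{0\}$ with $w\neq q^{\ell}$ for all $\ell\in\mathbb{Z}$. Then $$g_{2,1}(w;q)=g_{2,2}(w;q),$$ and if in addition $|w|>1$, then $$g_{2,1}(w;q)=g_{2,2}(w;q)=g_{2,3}(w;q).$$
   Context: Notation: $(a)_n=(a;q)_n:=\prod_{j=0}^{n-1}(1-aq^j)$ for $n\in\mathbb{N}_0$, and $(a_1,\dots,a_r)_n=(a_1,\dots,a_r;q)_n:=(a_1;q)_n\cdots(a_r;q)_n$. Definitions: $$g_{2,1}(w;q):=g_2(w;q):=\sum_{n\ge0}\frac{(-q)_nq^{\frac{n(n+1)}{2}}}{(w,w^{-1}q)_{n+1}},$$ $$O_2(w;q):=\sum_{n\ge0}\frac{(-1)_nq^{\frac{n(n+1)}2}}{(wq,w^{-1}q)_n},\qquad g_{2,2}(w;q):=\frac{1+w}{2w(1-w)}O_2(w;q)-\frac1{2w},$$ and, for $|w|>1$ and $w\neq q^{-\ell}$ $(\ell\in\mathbb{N}=\{1,2,\dots\})$, $$g_{2,3}(w;q):=-\frac{1+w}{2w^2}\sum_{n\ge0}\frac{(-wq)_n}{(wq)_n}w^{-n}-\frac1{2w}.$$ Here $(-1)_n=(-1;q)_n$ denotes the $q$-Pochhammer symbol with $a=-1$. *)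

theory Defs
  imports "HOL-Analysis.Analysis"
begin

definition qpoch :: "complex \<Rightarrow> complex \<Rightarrow> nat \<Rightarrow> complex" where
  "qpoch a q n = (\<Prod>j<n. 1 - a * q ^ j)"

definition qpoch2 :: "complex \<Rightarrow> complex \<Rightarrow> complex \<Rightarrow> nat \<Rightarrow> complex" where
  "qpoch2 a b q n = qpoch a q n * qpoch b q n"

text \<open>
  The functions below are total. They agree with the intended ones where \<open>0 < norm q < 1\<close>,
  \<open>w \<noteq> 0\<close> and \<open>w\<close> is not an integral power of \<open>q\<close> (for \<open>g23\<close> also \<open>1 < norm w\<close>): there no
  denominator vanishes and the series converge absolutely.
\<close>

definition g21 :: "complex \<Rightarrow> complex \<Rightarrow> complex" where
  "g21 w q = (\<Sum>n. qpoch (- q) q n * q ^ (n * (n + 1) div 2) / qpoch2 w (inverse w * q) q (n + 1))"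

definition O2 :: "complex \<Rightarrow> complex \<Rightarrow> complex" where
  "O2 w q = (\<Sum>n. qpoch (- 1) q n * q ^ (n * (n + 1) div 2) / qpoch2 (w * q) (inverse w * q) q n)"

definition g22 :: "complex \<Rightarrow> complex \<Rightarrow> complex" where
  "g22 w q = (1 + w) / (2 * w * (1 - w)) * O2 w q - 1 / (2 * w)"

definition g23 :: "complex \<Rightarrow> complex \<Rightarrow> complex" where
  "g23 w q = - ((1 + w) / (2 * w ^ 2))
     * (\<Sum>n. qpoch (- (w * q)) q n / qpoch (w * q) q n * w powi (- int n)) - 1 / (2 * w)"

end

theory Submission
  imports Defs
begin

text \<open>
  Let \<open>B n\<close> be the summand of \<open>O2 w q\<close> and \<open>T n = B n * (1 - w * q ^ n)\<close>. The summand of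
  \<open>2 * w * (1 - w) * g21 w q\<close> equals \<open>(1 + w) * B n + (T (n + 1) - T n)\<close>, and \<open>T\<close> tends to \<open>0\<close>
  from \<open>T 0 = 1 - w\<close>, which gives \<open>g21 = g22\<close>.

  For \<open>g22 = g23\<close>, put \<open>F(a,b;t) = (\<Sum>n. (aq)_n / (bq)_n * t ^ n)\<close>. Comparing coefficients of
  powers of \<open>t\<close> yields \<open>(1 - t) F(a,b;t) = 1 + (b - a) t q / (1 - b q) * F(a,bq;tq)\<close>. Iterating
  this gives N. J. Fine's transformation
  \<open>(1 - t) F(a,b;t) = (\<Sum>n. (b/a)_n (-at)^n q^(n(n+1)/2) / ((bq)_n (tq)_n))\<close>,
  whose right-hand side is \<open>O2 w q\<close> at \<open>a = -w\<close>, \<open>b = w\<close>, \<open>t = 1/w\<close>.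
\<close>

section \<open>q-Pochhammer symbols: recurrences and bounds\<close>

lemma qpoch_0 [simp]: "qpoch a q 0 = 1"
  by (simp add: qpoch_def)

lemma qpoch_Suc: "qpoch a q (Suc n) = qpoch a q n * (1 - a * q ^ n)"
  by (simp add: qpoch_def)

lemma qpoch_add: "qpoch a q (m + n) = qpoch a q m * qpoch (a * q ^ m) q n"
  by (induction n) (auto simp: qpoch_Suc power_add mult_ac)

lemma qpoch_Suc_left: "qpoch a q (Suc n) = (1 - a) * qpoch (a * q) q n"
  using qpoch_add[of a q 1 n] by (simp add: qpoch_Suc)

lemma qpoch_nonzero_iff: "qpoch a q n \<noteq> 0 \<longleftrightarrow> (\<forall>j<n. a * q ^ j \<noteq> 1)"
  by (auto simp: qpoch_def)

lemma convergent_prod_qpoch: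
  fixes a q :: complex
  assumes "norm q < 1"
  shows "convergent_prod (\<lambda>j. 1 - a * q ^ j)"
proof -
  have "summable (\<lambda>j. norm (- a * q ^ j))"
    using assms by (simp add: norm_mult norm_power summable_mult summable_geometric)
  then have "abs_convergent_prod (\<lambda>j. 1 + (- a * q ^ j))"
    by (subst summable_imp_abs_convergent_prod) auto
  then show ?thesis
    using abs_convergent_prod_imp_convergent_prod by fastforce
qed

lemma qpoch_bounded:
  assumes "norm q < 1"
  shows "\<exists>M>0. \<forall>n. norm (qpoch a q n) \<le> M"
proof -
  have "convergent (\<lambda>n. \<Prod>j\<le>n. 1 - a * q ^ j)"
    using convergent_prod_imp_convergent[OF convergent_prod_qpoch[OF assms]] .
  then have "convergent (\<lambda>n. qpoch a q (Suc n))"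
    by (simp add: qpoch_def lessThan_Suc_atMost)
  then have "Bseq (qpoch a q)"
    using convergent_Suc_iff convergent_imp_Bseq by blast
  then show ?thesis
    by (auto simp: Bseq_def)
qed

text \<open>Since no factor vanishes, the infinite product converges to a nonzero limit. The
  inverses of the partial products therefore converge too, and so are bounded.\<close>

lemma inverse_qpoch_bounded:
  assumes "norm q < 1" and "\<And>j. a * q ^ j \<noteq> 1"
  shows "\<exists>M>0. \<forall>n. norm (inverse (qpoch a q n)) \<le> M"
proof -
  have nz: "1 - a * q ^ j \<noteq> 0" for j
    using assms(2)[of j] by simp
  obtain L where L: "(\<lambda>n. \<Prod>j\<le>n. 1 - a * q ^ j) \<longlonglongrightarrow> L" "L \<noteq> 0"
    using convergent_prod_qpoch[OF assms(1), of a] nz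
    by (subst (asm) convergent_prod_iff_nz_lim) auto
  then have "(\<lambda>n. qpoch a q (Suc n)) \<longlonglongrightarrow> L"
    by (simp add: qpoch_def lessThan_Suc_atMost)
  then have "(\<lambda>n. inverse (qpoch a q n)) \<longlonglongrightarrow> inverse L"
    using L(2) by (intro tendsto_inverse) (simp_all add: filterlim_sequentially_Suc)
  then have "Bseq (\<lambda>n. inverse (qpoch a q n))"
    using convergentI convergent_imp_Bseq by blast
  then show ?thesis
    by (auto simp: Bseq_def)
qed

lemma norm_mult_power_less_1:
  fixes q t :: complex
  assumes "norm q < 1" "norm t < 1"
  shows "norm (t * q ^ N) < 1"
proof -
  have "norm (t * q ^ N) \<le> norm t"
    using assms by (simp add: norm_mult norm_power mult_left_le power_le_one)
  then show ?thesis using assms by simp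
qed

section \<open>Fine's function and its transformation\<close>

definition fine_term :: "complex \<Rightarrow> complex \<Rightarrow> complex \<Rightarrow> complex \<Rightarrow> nat \<Rightarrow> complex" where
  "fine_term q a b t n = qpoch (a * q) q n / qpoch (b * q) q n * t ^ n"

definition fine_dual :: "complex \<Rightarrow> complex \<Rightarrow> complex \<Rightarrow> complex \<Rightarrow> nat \<Rightarrow> complex" where
  "fine_dual q a b t n =
     qpoch (b / a) q n * (- a * t) ^ n * q ^ (n * (n + 1) div 2) / qpoch2 (b * q) (t * q) q n"

lemma triangular_Suc: "Suc n * (Suc n + 1) div 2 = n * (n + 1) div 2 + Suc n"
  by simp

text \<open>The factor \<open>- a * t\<close> clears the quotient \<open>b / a\<close>. In this form
  the ratio is the coefficient of the functional equation at \<open>b * q ^ n\<close>,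
  \<open>t * q ^ n\<close>, divided by \<open>1 - t * q ^ Suc n\<close>.\<close>

lemma fine_dual_Suc:
  assumes "a \<noteq> 0"
  shows "fine_dual q a b t (Suc n) = fine_dual q a b t n *
    ((b * q ^ n - a) * t * q ^ Suc n / ((1 - b * q ^ Suc n) * (1 - t * q ^ Suc n)))"
proof -
  have "(1 - b / a * q ^ n) * (- a * t) = (b * q ^ n - a) * t"
    using assms by (simp add: field_simps)
  moreover have "fine_dual q a b t (Suc n) = fine_dual q a b t n *
    ((1 - b / a * q ^ n) * (- a * t) * q ^ Suc n / ((1 - b * q ^ Suc n) * (1 - t * q ^ Suc n)))"
    unfolding fine_dual_def qpoch2_def qpoch_Suc triangular_Suc power_add power_Suc2
    by (simp add: mult_ac)
  ultimately show ?thesis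
    by (simp only:)
qed

text \<open>Uniformity in \<open>N\<close> is the point: it controls the remainder after
  \<open>N\<close> iterations, while \<open>N = 0\<close> gives summability. It holds because the
  shifted denominator is (bq)_(N+n) / (bq)_N, and the (bq)_m are bounded and bounded away from
  0.\<close>

lemma norm_fine_term_bound:
  assumes "norm q < 1" and "\<And>j. b * q ^ Suc j \<noteq> 1"
  shows "\<exists>C. \<forall>N n. norm (fine_term q a (b * q ^ N) (t * q ^ N) n) \<le> C * norm t ^ n"
proof -
  obtain M1 where M1: "M1 > 0" "\<And>n. norm (qpoch (a * q) q n) \<le> M1"
    using qpoch_bounded[OF assms(1)] by blast
  obtain M2 where M2: "M2 > 0" "\<And>n. norm (qpoch (b * q) q n) \<le> M2"
    using qpoch_bounded[OF assms(1)] by blast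
  obtain M3 where M3: "M3 > 0" "\<And>n. norm (inverse (qpoch (b * q) q n)) \<le> M3"
    using inverse_qpoch_bounded[OF assms(1), of "b * q"] assms(2) by (auto simp: mult_ac)
  have "norm (fine_term q a (b * q ^ N) (t * q ^ N) n) \<le> M1 * (M2 * M3) * norm t ^ n" for N n
  proof -
    have nz: "qpoch (b * q) q N \<noteq> 0"
      using assms(2) by (auto simp: qpoch_nonzero_iff mult_ac)
    have "fine_term q a (b * q ^ N) (t * q ^ N) n =
        qpoch (a * q) q n * (qpoch (b * q) q N * inverse (qpoch (b * q) q (N + n))) * (t * q ^ N) ^ n"
      using nz by (simp add: fine_term_def qpoch_add divide_inverse mult_ac)
    also have "norm \<dots> \<le> M1 * (M2 * M3) * norm t ^ n"
      unfolding norm_mult norm_power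
      using M1 M2 M3 assms(1)
      by (intro mult_mono power_mono mult_left_le power_le_one mult_nonneg_nonneg) auto
    finally show ?thesis .
  qed
  then show ?thesis by blast
qed

lemma summable_fine_term:
  assumes "norm q < 1" "norm t < 1" and "\<And>j. b * q ^ Suc j \<noteq> 1"
  shows "summable (fine_term q a b t)"
proof -
  obtain C where "\<And>N n. norm (fine_term q a (b * q ^ N) (t * q ^ N) n) \<le> C * norm t ^ n"
    using norm_fine_term_bound[OF assms(1,3), of a t] by blast
  from this[of 0] have "\<And>n. norm (fine_term q a b t n) \<le> C * norm t ^ n" by simp
  moreover have "summable (\<lambda>n. C * norm t ^ n)"
    using assms by (intro summable_mult summable_geometric) auto
  ultimately show ?thesis
    using summable_comparison_test'[of "\<lambda>n. C * norm t ^ n" 0 "fine_term q a b t"] by blast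
qed

text \<open>The coefficient of t^(n+1) in (1 - t) F(a,b;t) is a difference of consecutive
  coefficients of F. Over a common denominator it contains (1 - a q^(n+1)) - (1 - b q^(n+1)) = (b -
  a) q^(n+1), whose power q^n turns t^n into (tq)^n.\<close>

lemma suminf_fine_term_step:
  assumes "norm q < 1" "norm t < 1" and nz: "\<And>j. b * q ^ Suc j \<noteq> 1"
  shows "(1 - t) * (\<Sum>n. fine_term q a b t n) =
    1 + (b - a) * t * q / (1 - b * q) * (\<Sum>n. fine_term q a (b * q) (t * q) n)"
proof -
  have sm: "summable (fine_term q a b t)"
    by (rule summable_fine_term[OF assms])
  have nz': "b * q * q ^ Suc j \<noteq> 1" for j
    using nz[of "Suc j"] by (simp add: mult_ac)
  have tq: "norm (t * q) < 1"
    using norm_mult_power_less_1[OF assms(1,2), of 1] by simp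
  have sm': "summable (fine_term q a (b * q) (t * q))"
    by (rule summable_fine_term[OF assms(1) tq nz'])
  have step: "fine_term q a b t (Suc n) - t * fine_term q a b t n =
      (b - a) * t * q / (1 - b * q) * fine_term q a (b * q) (t * q) n" for n
  proof -
    define U where "U = qpoch (a * q) q n"
    define V where "V = qpoch (b * q) q n"
    define V' where "V' = qpoch (b * q * q) q n"
    have V: "V \<noteq> 0"
      using nz by (auto simp: V_def qpoch_nonzero_iff mult_ac)
    have V': "V' \<noteq> 0"
      using nz' by (auto simp: V'_def qpoch_nonzero_iff mult_ac)
    have b1: "1 - b * q \<noteq> 0" and b2: "1 - b * q * q ^ n \<noteq> 0"
      using nz[of 0] nz[of n] by (auto simp: mult_ac)
    \<comment> \<open>Both sides are \<open>qpoch (b * q) q (Suc n)\<close>, with the last or the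
      first factor split off. This trades the denominator for \<open>b\<close> for the one for
      \<open>b * q\<close>.\<close>
    have rel: "V * (1 - b * q * q ^ n) = (1 - b * q) * V'"
      unfolding V_def V'_def by (metis qpoch_Suc qpoch_Suc_left)
    have "fine_term q a b t (Suc n) - t * fine_term q a b t n =
        U * (1 - a * q * q ^ n) / (V * (1 - b * q * q ^ n)) * t ^ Suc n - t * (U / V * t ^ n)"
      by (simp add: fine_term_def U_def V_def qpoch_Suc)
    also have "\<dots> = (b - a) * q * q ^ n * U / (V * (1 - b * q * q ^ n)) * t ^ Suc n"
      using V b2 by (simp add: divide_simps) (simp add: algebra_simps)
    also have "\<dots> = (b - a) * t * q / (1 - b * q) * (U / V' * (t * q) ^ n)"
      unfolding rel using V' b1 by (simp add: field_simps)
    finally show ?thesis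
      by (simp add: fine_term_def U_def V'_def)
  qed
  have "(\<Sum>n. fine_term q a b t n) = 1 + (\<Sum>n. fine_term q a b t (Suc n))"
    using suminf_split_head[OF sm] by (simp add: fine_term_def[of _ _ _ _ 0])
  then have "(1 - t) * (\<Sum>n. fine_term q a b t n) =
      1 + ((\<Sum>n. fine_term q a b t (Suc n)) - t * (\<Sum>n. fine_term q a b t n))"
    by (simp add: algebra_simps)
  also have "\<dots> = 1 + (\<Sum>n. fine_term q a b t (Suc n) - t * fine_term q a b t n)"
    using suminf_diff[of "\<lambda>n. fine_term q a b t (Suc n)" "\<lambda>n. t * fine_term q a b t n"] sm
    by (simp add: suminf_mult summable_mult summable_Suc_iff)
  also have "\<dots> = 1 + (b - a) * t * q / (1 - b * q) * (\<Sum>n. fine_term q a (b * q) (t * q) n)"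
    unfolding step suminf_mult[OF sm'] ..
  finally show ?thesis .
qed

text \<open>Apply the functional equation to the remainder: its constant 1 yields the next term of
  the dual series, and its other summand is the new remainder.\<close>

lemma fine_partial_expansion:
  assumes "norm q < 1" "norm t < 1" "a \<noteq> 0" and nz: "\<And>j. b * q ^ Suc j \<noteq> 1"
  shows "(1 - t) * (\<Sum>n. fine_term q a b t n) = (\<Sum>n<N. fine_dual q a b t n) +
    fine_dual q a b t N * ((1 - t * q ^ N) * (\<Sum>n. fine_term q a (b * q ^ N) (t * q ^ N) n))"
proof (induction N)
  case 0
  then show ?case by (simp add: fine_dual_def qpoch2_def)
next
  case (Suc N)
  define S where "S = (\<Sum>n. fine_term q a (b * q ^ Suc N) (t * q ^ Suc N) n)"
  have t1: "1 - t * q ^ Suc N \<noteq> 0"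
    using norm_mult_power_less_1[OF assms(1,2), of "Suc N"] by auto
  have "b * q ^ N * q ^ Suc j \<noteq> 1" for j
    using nz[of "N + j"] by (simp add: power_add mult_ac)
  then have "(1 - t * q ^ N) * (\<Sum>n. fine_term q a (b * q ^ N) (t * q ^ N) n) =
      1 + (b * q ^ N - a) * (t * q ^ N) * q / (1 - b * q ^ N * q) *
        (\<Sum>n. fine_term q a (b * q ^ N * q) (t * q ^ N * q) n)"
    using assms norm_mult_power_less_1 by (intro suminf_fine_term_step) auto
  then have step: "(1 - t * q ^ N) * (\<Sum>n. fine_term q a (b * q ^ N) (t * q ^ N) n) =
      1 + (b * q ^ N - a) * t * q ^ Suc N / (1 - b * q ^ Suc N) * S"
    by (simp add: S_def mult_ac)
  \<comment> \<open>The factor \<open>1 - t * q ^ Suc N\<close> of the new remainder cancels the one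
    in the denominator of the ratio of dual terms.\<close>
  have dual_step: "fine_dual q a b t (Suc N) * ((1 - t * q ^ Suc N) * S) =
      fine_dual q a b t N * ((b * q ^ N - a) * t * q ^ Suc N / (1 - b * q ^ Suc N) * S)"
    unfolding fine_dual_Suc[OF assms(3)] using t1 by simp
  show ?case
    unfolding Suc sum.lessThan_Suc S_def[symmetric] step dual_step
    by (simp only: distrib_left mult_1_right add.assoc)
qed

text \<open>The ratio of consecutive terms carries q^(n+1) while its denominator tends to 1, so it
  tends to 0 and is eventually below 1/2.\<close>

lemma summable_fine_dual:
  assumes "norm q < 1" "a \<noteq> 0"
  shows "summable (fine_dual q a b t)"
proof -
  define r where "r = (\<lambda>n. (b * q ^ n - a) * t * q ^ Suc n /
    ((1 - b * q ^ Suc n) * (1 - t * q ^ Suc n)))"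
  have q0: "(\<lambda>n. q ^ n) \<longlonglongrightarrow> 0"
    using assms(1) by (rule LIMSEQ_power_zero)
  have q1: "(\<lambda>n. q ^ Suc n) \<longlonglongrightarrow> 0"
    using q0 by (rule LIMSEQ_Suc)
  have "r \<longlonglongrightarrow> (b * 0 - a) * t * 0 / ((1 - b * 0) * (1 - t * 0))"
    unfolding r_def by (intro tendsto_intros q0 q1) auto
  then have "r \<longlonglongrightarrow> 0"
    by simp
  then have "eventually (\<lambda>n. norm (r n) < 1 / 2) sequentially"
    using tendstoD[of r 0 sequentially "1 / 2"] by simp
  then obtain N where N: "norm (r n) < 1 / 2" if "n \<ge> N" for n
    by (auto simp: eventually_sequentially)
  have ratio: "fine_dual q a b t (Suc n) = fine_dual q a b t n * r n" for n
    by (simp only: r_def fine_dual_Suc[OF assms(2)])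
  have "norm (fine_dual q a b t (Suc n)) \<le> 1 / 2 * norm (fine_dual q a b t n)" if "n \<ge> N" for n
    using mult_right_mono[OF less_imp_le[OF N[OF that]], of "norm (fine_dual q a b t n)"]
    by (simp add: ratio norm_mult mult_ac)
  then show ?thesis
    by (intro summable_ratio_test[of "1 / 2" N]) auto
qed

text \<open>Let \<open>N\<close> tend to infinity in the finite expansion. The remainder is a dual
  term, which tends to 0, times a factor bounded uniformly by twice a geometric series.\<close>

theorem fine_dual_sums:
  assumes "norm q < 1" "norm t < 1" "a \<noteq> 0" and nz: "\<And>j. b * q ^ Suc j \<noteq> 1"
  shows "fine_dual q a b t sums ((1 - t) * (\<Sum>n. fine_term q a b t n))"
proof -
  define R where "R = (\<lambda>N. (1 - t * q ^ N) * (\<Sum>n. fine_term q a (b * q ^ N) (t * q ^ N) n))"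
  obtain C where C: "\<And>N n. norm (fine_term q a (b * q ^ N) (t * q ^ N) n) \<le> C * norm t ^ n"
    using norm_fine_term_bound[OF assms(1) nz, of a t] by blast
  have geo: "summable (\<lambda>n. C * norm t ^ n)"
    using assms(2) by (intro summable_mult summable_geometric) auto
  have "norm (R N) \<le> 2 * (\<Sum>n. C * norm t ^ n)" for N
  proof -
    have "norm (1 - t * q ^ N) \<le> 1 + norm (t * q ^ N)"
      using norm_triangle_ineq4[of 1 "t * q ^ N"] by simp
    also have "\<dots> \<le> 2"
      using norm_mult_power_less_1[OF assms(1,2), of N] by simp
    finally show ?thesis
      unfolding R_def norm_mult using norm_suminf_le[OF C geo]
      by (intro mult_mono) auto
  qed
  then have R: "Bfun R sequentially"
    by (intro BfunI always_eventually) auto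
  have "Zfun (fine_dual q a b t) sequentially"
    using summable_LIMSEQ_zero[OF summable_fine_dual[OF assms(1,3)]]
    by (simp add: tendsto_Zfun_iff)
  from this R have "Zfun (\<lambda>N. fine_dual q a b t N * R N) sequentially"
    by (rule bounded_bilinear.Zfun_prod_Bfun[OF bounded_bilinear_mult])
  then have "(\<lambda>N. fine_dual q a b t N * R N) \<longlonglongrightarrow> 0"
    by (simp add: tendsto_Zfun_iff)
  then have "(\<lambda>N. (1 - t) * (\<Sum>n. fine_term q a b t n) - fine_dual q a b t N * R N)
      \<longlonglongrightarrow> (1 - t) * (\<Sum>n. fine_term q a b t n) - 0"
    by (intro tendsto_intros)
  moreover have "(1 - t) * (\<Sum>n. fine_term q a b t n) - fine_dual q a b t N * R N =
      (\<Sum>n<N. fine_dual q a b t n)" for N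
    using fine_partial_expansion[OF assms, of N] by (simp add: R_def)
  ultimately show ?thesis
    by (simp add: sums_def)
qed

section \<open>The telescoping relation between \<open>g21\<close> and \<open>O2\<close>\<close>

definition g21_term :: "complex \<Rightarrow> complex \<Rightarrow> nat \<Rightarrow> complex" where
  "g21_term w q n = qpoch (- q) q n * q ^ (n * (n + 1) div 2) / qpoch2 w (inverse w * q) q (n + 1)"

definition O2_term :: "complex \<Rightarrow> complex \<Rightarrow> nat \<Rightarrow> complex" where
  "O2_term w q n = qpoch (- 1) q n * q ^ (n * (n + 1) div 2) / qpoch2 (w * q) (inverse w * q) q n"

lemma g21_eq_suminf: "g21 w q = suminf (g21_term w q)"
  by (simp add: g21_def g21_term_def[abs_def])

lemma O2_eq_suminf: "O2 w q = suminf (O2_term w q)"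
  by (simp add: O2_def O2_term_def[abs_def])

text \<open>For these parameters b/a = -1 and -at = 1.\<close>

lemma O2_term_eq_fine_dual:
  assumes "w \<noteq> 0"
  shows "O2_term w q = fine_dual q (- w) w (inverse w)"
  using assms by (auto simp: O2_term_def fine_dual_def)

text \<open>With x = q^n and \<open>K\<close> as below, the left side is K w^2 / (w - qx). Split w^2
  / (w - qx) = w + qxw / (w - qx): the second part gives \<open>T (Suc n)\<close>, the first gives
  the other terms because (1 + w) - (1 - wx) = w (1 + x).\<close>

lemma g21_term_telescope:
  assumes "norm q < 1" "w \<noteq> 0" and nz: "\<And>j. w * q ^ j \<noteq> 1" "\<And>j. inverse w * q ^ j \<noteq> 1"
  defines "T \<equiv> \<lambda>n. O2_term w q n * (1 - w * q ^ n)"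
  shows "2 * w * (1 - w) * g21_term w q n = (1 + w) * O2_term w q n + (T (Suc n) - T n)"
proof -
  define x where "x = q ^ n"
  define D where "D = qpoch2 (w * q) (inverse w * q) q n"
  define P where "P = qpoch (- q) q n"
  define Q where "Q = q ^ (n * (n + 1) div 2)"
  \<comment> \<open>Either n = 0 and x = 1, or \<open>x\<close> has norm below 1; so
    \<open>x\<close> is never -1.\<close>
  have x1: "1 + x \<noteq> 0"
  proof (cases n)
    case (Suc m)
    then have "norm x < 1"
      using norm_mult_power_less_1[OF assms(1,1), of m] by (simp add: x_def)
    then show ?thesis
      by (metis add_eq_0_iff norm_minus_cancel norm_one order_less_irrefl)
  qed (auto simp: x_def)
  have w1: "1 - w \<noteq> 0" and w2: "1 - w * q * x \<noteq> 0" and w3: "w - q * x \<noteq> 0"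
    using nz(1)[of 0] nz(1)[of "Suc n"] nz(2)[of "Suc n"] assms(2)
    by (auto simp: x_def field_simps)
  \<comment> \<open>Split (-1)_(n+1) at its first factor, which is 2, and at its last, which is 1 +
    x.\<close>
  have m1': "qpoch (- 1) q n * (1 + x) = 2 * P"
    using qpoch_Suc_left[of "- 1" q n] qpoch_Suc[of "- 1" q n]
    by (simp add: P_def x_def)
  then have m1: "qpoch (- 1) q n = 2 * P / (1 + x)"
    using x1 by (simp add: nonzero_eq_divide_eq)
  have w0: "qpoch w q (n + 1) = (1 - w) * qpoch (w * q) q n"
    using qpoch_Suc_left[of w q n] by simp
  have A: "g21_term w q n = P * Q / (D * (1 - w) * (1 - inverse w * q * x))"
    unfolding g21_term_def qpoch2_def w0
    by (simp add: qpoch2_def D_def P_def Q_def qpoch_Suc x_def mult_ac)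
  have B: "O2_term w q n = 2 * P * Q / (D * (1 + x))"
    by (simp add: O2_term_def m1 D_def Q_def mult_ac)
  have T': "T (Suc n) = 2 * P * Q * q * x / (D * (1 - inverse w * q * x))"
  proof -
    have "O2_term w q (Suc n) = qpoch (- 1) q n * (1 + x) * (Q * (q * x)) /
        (D * ((1 - w * q * x) * (1 - inverse w * q * x)))"
      unfolding O2_term_def triangular_Suc qpoch2_def qpoch_Suc power_add
      by (simp add: D_def Q_def x_def qpoch2_def mult_ac)
    then have O2': "O2_term w q (Suc n) = 2 * P * (Q * (q * x)) /
        (D * ((1 - w * q * x) * (1 - inverse w * q * x)))"
      by (simp only: m1')
    have T2: "T (Suc n) = O2_term w q (Suc n) * (1 - w * q * x)"
      by (simp add: T_def x_def)
    have cancel: "N / (D * (E * F)) * E = N / (D * F)" if "E \<noteq> 0" for N E F :: complex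
      using that by simp
    show ?thesis
      unfolding T2 O2' cancel[OF w2] by (simp only: mult.assoc)
  qed
  define K where "K = 2 * P * Q / D"
  have i: "1 - inverse w * q * x = (w - q * x) / w"
    using assms(2) by (simp add: field_simps)
  have "2 * w * (1 - w) * g21_term w q n = K * (w * w / (w - q * x))"
    unfolding A i K_def using w1 by simp
  also have "w * w / (w - q * x) = w + q * x * w / (w - q * x)"
    using w3 by (simp add: field_simps)
  also have "K * \<dots> = K * w + T (Suc n)"
    unfolding T' i K_def distrib_left by simp
  also have "K * w = (1 + w) * O2_term w q n - T n"
  proof -
    have "(1 + w) * O2_term w q n - T n = O2_term w q n * (w * (1 + x))"
      by (simp add: T_def x_def algebra_simps)
    also have "\<dots> = K * w"
      unfolding B K_def using x1 by simp
    finally show ?thesis ..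
  qed
  finally show ?thesis
    by simp
qed

theorem theorem4p1:
  fixes q w :: complex
  assumes "0 < norm q" and "norm q < 1"
    and "w \<noteq> 0"
    and "\<And>l :: int. w \<noteq> q powi l"
  shows "g21 w q = g22 w q \<and>
    (norm w > 1 \<longrightarrow> g21 w q = g22 w q \<and> g22 w q = g23 w q)"
proof -
  \<comment> \<open>The nonpositive exponents keep the factors in \<open>w\<close> nonzero, the
    nonnegative ones those in \<open>inverse w\<close>.\<close>
  have nz1: "w * q ^ j \<noteq> 1" for j
    using assms(4)[of "- int j"] assms(1)
    by (auto simp: power_int_minus field_simps)
  have nz2: "inverse w * q ^ j \<noteq> 1" for j
    using assms(4)[of "int j"] assms(3) by (auto simp: field_simps)
  have w1: "1 - w \<noteq> 0"
    using nz1[of 0] by simp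
  define T where "T = (\<lambda>n. O2_term w q n * (1 - w * q ^ n))"
  \<comment> \<open>The dual series is summable for every \<open>t\<close>, so this covers every
    \<open>w\<close> considered, whatever its norm.\<close>
  have O2_summable: "summable (O2_term w q)"
    using assms(2,3) by (simp add: O2_term_eq_fine_dual summable_fine_dual)
  have "T \<longlonglongrightarrow> 0 * (1 - w * 0)"
    unfolding T_def
    by (intro tendsto_mult tendsto_diff tendsto_const summable_LIMSEQ_zero[OF O2_summable]
        LIMSEQ_power_zero assms(2))
  then have "(\<lambda>n. T (Suc n) - T n) sums (0 - T 0)"
    by (intro telescope_sums) simp
  moreover have "T 0 = 1 - w"
    by (simp add: T_def O2_term_def qpoch2_def)
  moreover have "O2_term w q sums O2 w q"
    using summable_sums[OF O2_summable] by (simp add: O2_eq_suminf)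
  ultimately have "(\<lambda>n. (1 + w) * O2_term w q n + (T (Suc n) - T n)) sums
      ((1 + w) * O2 w q + (0 - (1 - w)))"
    by (intro sums_add sums_mult) auto
  then have "(\<lambda>n. 2 * w * (1 - w) * g21_term w q n) sums ((1 + w) * O2 w q + (w - 1))"
    using g21_term_telescope[OF assms(2,3) nz1 nz2] by (simp add: T_def)
  \<comment> \<open>Convergence of the series for \<open>g21\<close> is obtained here together with
    its value.\<close>
  from sums_divide[OF this, of "2 * w * (1 - w)"]
  have "g21_term w q sums (((1 + w) * O2 w q + (w - 1)) / (2 * w * (1 - w)))"
    using w1 assms(3) by simp
  then have "g21 w q = ((1 + w) * O2 w q + (w - 1)) / (2 * w * (1 - w))"
    by (simp add: g21_eq_suminf sums_iff)
  also have "\<dots> = (1 + w) * O2 w q / (2 * w * (1 - w)) - (1 - w) / (2 * w * (1 - w))"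
    by (simp only: diff_divide_distrib[symmetric] add_diff_eq diff_diff_eq2)
  also have "(1 - w) / (2 * w * (1 - w)) = 1 / (2 * w)"
    using w1 by simp
  finally have g21_g22: "g21 w q = g22 w q"
    by (simp add: g22_def)
  have "g22 w q = g23 w q" if "norm w > 1"
  proof -
    \<comment> \<open>This is where \<open>norm w > 1\<close> enters: Fine's transformation applies
      at t = 1/w, and \<open>S\<close> is the series in \<open>g23\<close>.\<close>
    have t: "norm (inverse w) < 1"
      using that by (simp add: norm_inverse inverse_less_1_iff)
    define S where "S = (\<Sum>n. fine_term q (- w) w (inverse w) n)"
    have "O2_term w q sums ((1 - inverse w) * S)"
      using fine_dual_sums[OF assms(2) t, of "- w" w] nz1 assms(3)
      by (simp add: O2_term_eq_fine_dual S_def del: power_Suc)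
    then have O2: "O2 w q = (1 - inverse w) * S"
      by (simp add: O2_eq_suminf sums_iff)
    have "g23 w q = - ((1 + w) / (2 * w ^ 2)) * S - 1 / (2 * w)"
      by (simp add: g23_def S_def fine_term_def power_int_minus power_inverse)
    \<comment> \<open>The factor 1 - t of the transformation cancels 1 - w in the prefactor of
      \<open>g22\<close> and supplies the minus sign and the second power of \<open>w\<close> in
      that of \<open>g23\<close>.\<close>
    moreover have "1 - inverse w = - ((1 - w) / w)"
      using assms(3) by (simp add: field_simps)
    then have "g22 w q = - ((1 + w) / (2 * w * (1 - w)) * ((1 - w) / w)) * S - 1 / (2 * w)"
      by (simp add: g22_def O2)
    moreover have "(1 + w) / (2 * w * (1 - w)) * ((1 - w) / w) = (1 + w) / (2 * w ^ 2)"
      using w1 by (simp add: power2_eq_square)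
    ultimately show ?thesis
      by (simp only:)
  qed
  with g21_g22 show ?thesis
    by blast
qed

end
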